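(* As $n\to\infty$, the number of faces of the metric cone $$\mathrm{MET}_n=\{x\in\mathbb{R}^{\binom{[n]}{2}} : x_{a,b}+x_{b,c}-x_{a,c}\ge 0 \ \text{ for all distinct } a,b,c\in[n]\}$$ is at most $2^{2.38\, n^2(1+o(1))}$.
   Context: $[n]=\{1,\dots,n\}$; $\binom{[n]}{2}$ is the set of unordered pairs of distinct elements of $[n]$, and $x_{a,b}=x_{b,a}$ is the coordinate of $x$ at $\{a,b\}$. Faces are the (non-empty) faces of the polyhedral cone $\mathrm{MET}_n$ of all dimensions. *)

theory Defs
  imports "HOL-Analysis.Analysis" "HOL-Analysis.Finite_Function_Topology" "HOL-Library.Ramsey" "HOL-Library.Landau_Symbols"
begin

text \<open>
  As \<open>n\<close> varies inside the statement, the spaces of real vectors indexed by the 2-subsets of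
  \<open>{1..n}\<close> are all realised inside the single real vector space \<^typ>\<open>nat set \<Rightarrow>\<^sub>0 real\<close>, the
  \<open>n\<close>-th one as the coordinate subspace of the vectors supported on these 2-subsets.
\<close>

definition metric_cone :: "nat \<Rightarrow> (nat set \<Rightarrow>\<^sub>0 real) set" where
  "metric_cone n = {x. Poly_Mapping.keys x \<subseteq> nsets {1..n} 2 \<and>
     (\<forall>a\<in>{1..n}. \<forall>b\<in>{1..n}. \<forall>c\<in>{1..n}. a \<noteq> b \<and> b \<noteq> c \<and> a \<noteq> c \<longrightarrow>
        Poly_Mapping.lookup x {a, b} + Poly_Mapping.lookup x {b, c}
          - Poly_Mapping.lookup x {a, c} \<ge> 0)}"

definition metric_cone_faces :: "nat \<Rightarrow> (nat set \<Rightarrow>\<^sub>0 real) set set" where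
  "metric_cone_faces n = {F. F face_of metric_cone n \<and> F \<noteq> {}}"

end

theory Submission
  imports Defs
begin

text \<open>
  Let \<open>d = n choose 2\<close>, the number of coordinates. Every nonempty face of a polyhedral cone
  consists of the points of the cone at which the constraints that are tight on the face vanish
  (\<open>face_eq_tight_constraints\<close>). Viewed as vectors, these constraints are spanned by a linearly
  independent subset, which has at most \<open>d\<close> elements. The sum \<open>w\<close> of that subset
  already determines the face: on the cone all its summands are nonnegative, so the functional \<open>w\<close>
  vanishes exactly where each summand does (\<open>face_eq_vanishing_of_short_sum\<close>).

  Hence faces can be counted by lattice points. A triangle inequality has two coefficients \<open>1\<close> and
  one coefficient \<open>-1\<close>, so \<open>w = u - v\<close> for vectors \<open>u\<close>, \<open>v\<close> of natural numbers with entry sums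
  at most \<open>2 d\<close> and \<open>d\<close>. There are \<open>3 d choose d\<close> such \<open>u\<close> and \<open>2 d choose d\<close> such \<open>v\<close>, which
  is at most \<open>(27/4) ^ d\<close> and \<open>4 ^ d\<close>. So there are at most
  \<open>27 ^ d\<close> faces, and the exponent is \<open>d * log 2 27 \<le> n\<^sup>2 / 2 * 4.76 = 2.38 * n\<^sup>2\<close>. The bound holds
  for every \<open>n\<close>, with error term zero.
\<close>

section \<open>Faces of polyhedral cones\<close>

text \<open>
  The face contains a point \<open>y\<close> at which every constraint that is not tight on the whole face is
  strict. If \<open>x\<close> is a point of the cone at which the tight constraints vanish, then the segment from
  \<open>x\<close> to \<open>y\<close> can be prolonged beyond \<open>y\<close> inside the cone, and the defining property of a face
  puts \<open>x\<close> into it.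
\<close>

lemma face_eq_tight_constraints:
  fixes \<phi> :: "'i \<Rightarrow> 'a::real_vector \<Rightarrow> real"
  assumes S: "subspace S" and I: "finite I" and lin: "\<And>i. i \<in> I \<Longrightarrow> linear (\<phi> i)"
    and C: "C = {x \<in> S. \<forall>i\<in>I. 0 \<le> \<phi> i x}"
    and F: "F face_of C" "F \<noteq> {}"
  shows "F = {x \<in> C. \<forall>i\<in>I. (\<forall>y\<in>F. \<phi> i y = 0) \<longrightarrow> \<phi> i x = 0}"
proof
  have FC: "F \<subseteq> C" and convF: "convex F"
    using F by (auto simp: face_of_def)
  then show "F \<subseteq> {x \<in> C. \<forall>i\<in>I. (\<forall>y\<in>F. \<phi> i y = 0) \<longrightarrow> \<phi> i x = 0}"
    by auto
  define J where "J = {i \<in> I. \<exists>y\<in>F. \<phi> i y \<noteq> 0}"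
  have "finite J"
    unfolding J_def using I by auto
  \<comment> \<open>Averaging points at which single constraints are slack gives a relative interior point.\<close>
  moreover have "\<exists>y\<in>F. \<forall>i\<in>J'. 0 < \<phi> i y" if "finite J'" "J' \<subseteq> J" for J'
    using that
  proof (induction J' rule: finite_induct)
    case empty
    then show ?case using F by auto
  next
    case (insert j J')
    then obtain y where y: "y \<in> F" "\<forall>i\<in>J'. 0 < \<phi> i y" by auto
    from insert obtain z where z: "z \<in> F" "\<phi> j z \<noteq> 0" by (auto simp: J_def)
    define m where "m = (1/2) *\<^sub>R y + (1/2) *\<^sub>R z"
    have "m \<in> F"
      unfolding m_def using convF y z by (intro convexD) auto
    have m: "\<phi> i m = \<phi> i y / 2 + \<phi> i z / 2" if "i \<in> I" for i
      using lin[OF that] by (simp add: m_def linear_add linear_scale)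
    have "0 < \<phi> i m" if "i \<in> insert j J'" for i
    proof -
      have i: "i \<in> I" using that insert.prems by (auto simp: J_def)
      then have "0 \<le> \<phi> i y" "0 \<le> \<phi> i z" using y z FC C by auto
      moreover have "0 < \<phi> i y \<or> \<phi> i z \<noteq> 0" using that y z by auto
      ultimately show ?thesis using m[OF i] by linarith
    qed
    then show ?case using \<open>m \<in> F\<close> by blast
  qed
  ultimately obtain y where y: "y \<in> F" "\<forall>i\<in>J. 0 < \<phi> i y" by blast
  show "{x \<in> C. \<forall>i\<in>I. (\<forall>y\<in>F. \<phi> i y = 0) \<longrightarrow> \<phi> i x = 0} \<subseteq> F"
  proof clarify
    fix x assume x: "x \<in> C" and tight: "\<forall>i\<in>I. (\<forall>y\<in>F. \<phi> i y = 0) \<longrightarrow> \<phi> i x = 0"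
    show "x \<in> F"
    proof (cases "x = y")
      case True
      then show ?thesis using y by simp
    next
      case False
      have "\<forall>\<^sub>F e in at_right (0::real). \<forall>i\<in>J. e * \<phi> i x \<le> \<phi> i y"
      proof (intro eventually_ball_finite \<open>finite J\<close> ballI)
        fix i assume "i \<in> J"
        then have "0 < \<phi> i y" using y by auto
        moreover have "((\<lambda>e. e * \<phi> i x) \<longlongrightarrow> 0 * \<phi> i x) (at_right 0)"
          by (intro tendsto_intros)
        ultimately have "\<forall>\<^sub>F e in at_right 0. e * \<phi> i x < \<phi> i y"
          by (intro order_tendstoD) auto
        then show "\<forall>\<^sub>F e in at_right 0. e * \<phi> i x \<le> \<phi> i y"
          by eventually_elim simp
      qed
      moreover have "\<forall>\<^sub>F e in at_right (0::real). 0 < e"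
        by (rule eventually_at_right_less)
      ultimately obtain e where e: "0 < e" "\<forall>i\<in>J. e * \<phi> i x \<le> \<phi> i y"
        by (metis (mono_tags, lifting) eventually_conj eventually_happens' trivial_limit_at_right_real)
      \<comment> \<open>Prolong the segment from \<open>x\<close> to \<open>y\<close> slightly beyond \<open>y\<close>, without leaving the cone.\<close>
      define z where "z = y + e *\<^sub>R (y - x)"
      have yC: "y \<in> C" using y FC by auto
      have "0 \<le> \<phi> i z" if i: "i \<in> I" for i
      proof -
        have eq: "\<phi> i z = \<phi> i y + e * (\<phi> i y - \<phi> i x)"
          using lin[OF i] by (simp add: z_def linear_add linear_scale linear_diff)
        have nn: "0 \<le> \<phi> i y" using yC C i by auto
        show ?thesis
        proof (cases "i \<in> J")
          case True
          then have "e * \<phi> i x \<le> \<phi> i y" "0 \<le> e * \<phi> i y" using e nn by auto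
          then show ?thesis unfolding eq right_diff_distrib by linarith
        next
          case False
          then have "\<forall>y\<in>F. \<phi> i y = 0" using i by (auto simp: J_def)
          then show ?thesis using tight i y eq by auto
        qed
      qed
      moreover have "z \<in> S"
        unfolding z_def using S x yC C by (auto intro!: subspace_add subspace_scale subspace_diff)
      ultimately have zC: "z \<in> C" using C by auto
      have "y = (1 - 1 / (1 + e)) *\<^sub>R x + (1 / (1 + e)) *\<^sub>R z"
      proof -
        have "(1 + e) *\<^sub>R y = e *\<^sub>R x + z" by (simp add: z_def algebra_simps)
        then have "(1 / (1 + e)) *\<^sub>R (1 + e) *\<^sub>R y = (1 / (1 + e)) *\<^sub>R (e *\<^sub>R x + z)" by simp
        moreover have "1 - 1 / (1 + e) = e / (1 + e)" using e by (simp add: field_simps)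
        ultimately show ?thesis using e by (simp add: scaleR_add_right)
      qed
      moreover have "x \<noteq> z"
      proof
        assume "x = z"
        then have "(1 + e) *\<^sub>R (y - x) = 0" by (simp add: z_def algebra_simps)
        then show False using e False by simp
      qed
      moreover have "0 < 1 / (1 + e)" "1 / (1 + e) < 1"
        using e by (auto simp: field_simps)
      ultimately have "y \<in> open_segment x z"
        unfolding in_segment by blast
      then show "x \<in> F"
        using F(1) x zC y(1) by (auto simp: face_of_def)
    qed
  qed
qed

text \<open>
  Constraints are represented by vectors of the same type as the points, so that linear
  independence and spans of constraints are available.
\<close>

definition pairing :: "'e set \<Rightarrow> ('e \<Rightarrow>\<^sub>0 real) \<Rightarrow> ('e \<Rightarrow>\<^sub>0 real) \<Rightarrow> real" where
  "pairing E w x = (\<Sum>e\<in>E. Poly_Mapping.lookup w e * Poly_Mapping.lookup x e)"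

lemma lookup_scaleR_poly_mapping:
  "Poly_Mapping.lookup (r *\<^sub>R x) i = r *\<^sub>R Poly_Mapping.lookup (x :: 'a \<Rightarrow>\<^sub>0 'b::real_vector) i"
proof -
  have "{i. r *\<^sub>R Poly_Mapping.lookup x i \<noteq> 0} \<subseteq> {i. Poly_Mapping.lookup x i \<noteq> 0}" by auto
  then have "finite {i. r *\<^sub>R Poly_Mapping.lookup x i \<noteq> 0}"
    using finite_lookup finite_subset by blast
  then show ?thesis
    by (simp add: scaleR_poly_mapping_def)
qed

lemma linear_pairing_right: "linear (pairing E w)"
  by (rule linearI)
    (simp_all add: pairing_def lookup_add lookup_scaleR_poly_mapping algebra_simps sum.distrib sum_distrib_left)

lemma linear_pairing_left: "linear (\<lambda>w. pairing E w x)"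
  by (rule linearI)
    (simp_all add: pairing_def lookup_add lookup_scaleR_poly_mapping algebra_simps sum.distrib sum_distrib_left)

lemma in_span_singles:
  fixes w :: "'e \<Rightarrow>\<^sub>0 real"
  assumes "finite E" "Poly_Mapping.keys w \<subseteq> E"
  shows "w \<in> span ((\<lambda>e. Poly_Mapping.single e 1) ` E)"
proof -
  have "w = (\<Sum>e\<in>E. Poly_Mapping.lookup w e *\<^sub>R Poly_Mapping.single e 1)"
  proof (rule poly_mapping_eqI)
    fix k
    have "(\<Sum>e\<in>E. Poly_Mapping.lookup w e * (1 when e = k)) = (\<Sum>e\<in>E. if e = k then Poly_Mapping.lookup w e else 0)"
      by (rule sum.cong) auto
    also have "\<dots> = Poly_Mapping.lookup w k"
      using assms by (auto simp: in_keys_iff)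
    finally show "Poly_Mapping.lookup w k = Poly_Mapping.lookup (\<Sum>e\<in>E. Poly_Mapping.lookup w e *\<^sub>R Poly_Mapping.single e 1) k"
      by (simp add: lookup_sum lookup_scaleR_poly_mapping lookup_single)
  qed
  also have "\<dots> \<in> span ((\<lambda>e. Poly_Mapping.single e 1) ` E)"
    by (intro span_sum span_scale span_base) auto
  finally show ?thesis .
qed

text \<open>
  A basis of the span of the tight constraints, chosen among them, has at most \<open>card E\<close> elements
  and the same common zeros as all tight constraints together. Summing it compresses the whole set
  of tight constraints into a single vector that still remembers the face. The bound on \<open>card B\<close> is
  what keeps the entries of this vector small.
\<close>

lemma face_eq_vanishing_of_short_sum:
  fixes W :: "'i \<Rightarrow> ('e \<Rightarrow>\<^sub>0 real)"
  assumes E: "finite E" and I: "finite I" and W: "\<And>i. i \<in> I \<Longrightarrow> Poly_Mapping.keys (W i) \<subseteq> E"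
    and C: "C = {x. Poly_Mapping.keys x \<subseteq> E \<and> (\<forall>i\<in>I. 0 \<le> pairing E (W i) x)}"
    and F: "F face_of C" "F \<noteq> {}"
  obtains B where "B \<subseteq> I" "card B \<le> card E" "F = {x \<in> C. pairing E (\<Sum>i\<in>B. W i) x = 0}"
proof -
  define T where "T = {i \<in> I. \<forall>y\<in>F. pairing E (W i) y = 0}"
  have S: "subspace {x :: 'e \<Rightarrow>\<^sub>0 real. Poly_Mapping.keys x \<subseteq> E}"
    unfolding subspace_def
  proof (intro conjI ballI allI)
    fix x y :: "'e \<Rightarrow>\<^sub>0 real" and c :: real
    assume x: "x \<in> {x. Poly_Mapping.keys x \<subseteq> E}"
    then show "c *\<^sub>R x \<in> {x. Poly_Mapping.keys x \<subseteq> E}"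
      by (auto simp: in_keys_iff lookup_scaleR_poly_mapping)
    assume "y \<in> {x. Poly_Mapping.keys x \<subseteq> E}"
    then show "x + y \<in> {x. Poly_Mapping.keys x \<subseteq> E}"
      using x keys_add[of x y] by auto
  qed auto
  have FT: "F = {x \<in> C. \<forall>i\<in>T. pairing E (W i) x = 0}"
    using face_eq_tight_constraints[OF S I linear_pairing_right _ F, of "\<lambda>_. E" W] C
    by (auto simp: T_def)
  obtain V where V: "V \<subseteq> W ` T" "independent V" "W ` T \<subseteq> span V"
    using maximal_independent_subset by blast
  have "V \<subseteq> span ((\<lambda>e. Poly_Mapping.single e 1) ` E)"
    using V(1) W E by (auto simp: T_def intro!: in_span_singles)
  then have "finite V" "card V \<le> card ((\<lambda>e. Poly_Mapping.single e (1::real)) ` E)"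
    using independent_span_bound[OF _ V(2)] E by blast+
  then have cardV: "card V \<le> card E"
    using card_image_le[OF E] le_trans by blast
  obtain B where B: "B \<subseteq> T" "inj_on W B" "V = W ` B"
    using V(1) by (meson subset_image_inj)
  have BI: "B \<subseteq> I" using B by (auto simp: T_def)
  have finB: "finite B" using BI I finite_subset by blast
  \<comment> \<open>On the cone every summand is nonnegative, so the sum vanishes only if all summands do.\<close>
  have "pairing E (\<Sum>i\<in>B. W i) x = 0 \<longleftrightarrow> (\<forall>i\<in>T. pairing E (W i) x = 0)" if x: "x \<in> C" for x
  proof -
    have "pairing E (\<Sum>i\<in>B. W i) x = (\<Sum>i\<in>B. pairing E (W i) x)"
      by (rule linear_sum[OF linear_pairing_left])
    also have "\<dots> = 0 \<longleftrightarrow> (\<forall>i\<in>B. pairing E (W i) x = 0)"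
      using x C BI finB by (intro sum_nonneg_eq_0_iff) auto
    also have "\<dots> \<longleftrightarrow> (\<forall>i\<in>T. pairing E (W i) x = 0)"
    proof
      assume *: "\<forall>i\<in>B. pairing E (W i) x = 0"
      have "span V \<subseteq> {w. pairing E w x = 0}"
        using * B(3) by (intro span_minimal linear_subspace_kernel linear_pairing_left) auto
      then show "\<forall>i\<in>T. pairing E (W i) x = 0" using V(3) by auto
    qed (use B in auto)
    finally show ?thesis .
  qed
  then have "F = {x \<in> C. pairing E (\<Sum>i\<in>B. W i) x = 0}"
    using FT by blast
  moreover have "card B \<le> card E"
    using cardV B by (simp add: card_image)
  ultimately show thesis using that BI by blast
qed

section \<open>Counting cut-out faces by lattice points\<close>

definition bounded_vectors :: "'e set \<Rightarrow> nat \<Rightarrow> ('e \<Rightarrow> nat) set" where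
  "bounded_vectors E m = {u \<in> E \<rightarrow>\<^sub>E UNIV. sum u E \<le> m}"

lemma bounded_vectors_subset:
  assumes "finite E" shows "bounded_vectors E m \<subseteq> E \<rightarrow>\<^sub>E {..m}"
proof
  fix u assume u: "u \<in> bounded_vectors E m"
  have "u e \<le> m" if "e \<in> E" for e
    using member_le_sum[of e E u] that assms u by (auto simp: bounded_vectors_def)
  then show "u \<in> E \<rightarrow>\<^sub>E {..m}"
    using u by (auto simp: bounded_vectors_def PiE_iff)
qed

lemma finite_bounded_vectors: "finite E \<Longrightarrow> finite (bounded_vectors E m)"
  by (rule finite_subset[OF bounded_vectors_subset]) (auto intro: finite_PiE)

text \<open>
  Weighting the vector \<open>u\<close> by \<open>z ^ sum u E\<close>, which is at least \<open>z ^ m\<close>, turns the count into a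
  product of geometric series. With \<open>m = p * card E\<close> the best choice is \<open>z = p / (p + 1)\<close>, and the
  bound then has the exponential growth rate of the exact count \<open>(card E + m) choose m\<close>.
\<close>

lemma card_bounded_vectors_le:
  fixes z :: real
  assumes E: "finite E" and z: "0 < z" "z < 1"
  shows "real (card (bounded_vectors E m)) \<le> (1 / z) ^ m * (1 / (1 - z)) ^ card E"
proof -
  have "real (card (bounded_vectors E m)) * z ^ m = (\<Sum>u\<in>bounded_vectors E m. z ^ m)"
    by simp
  also have "\<dots> \<le> (\<Sum>u\<in>bounded_vectors E m. z ^ sum u E)"
    using z by (intro sum_mono power_decreasing) (auto simp: bounded_vectors_def)
  also have "\<dots> \<le> (\<Sum>u\<in>E \<rightarrow>\<^sub>E {..m}. z ^ sum u E)"
    using z E by (intro sum_mono2 bounded_vectors_subset finite_PiE) auto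
  also have "\<dots> = (\<Sum>u\<in>E \<rightarrow>\<^sub>E {..m}. \<Prod>e\<in>E. z ^ u e)"
    by (simp add: power_sum)
  also have "\<dots> = (\<Prod>e\<in>E. \<Sum>k\<le>m. z ^ k)"
    using E by (intro prod_sum_PiE[symmetric]) auto
  also have "\<dots> \<le> (\<Prod>e\<in>E. 1 / (1 - z))"
  proof (rule prod_mono)
    have "(\<Sum>k\<le>m. z ^ k) = (1 - z ^ Suc m) / (1 - z)"
      using z by (subst sum_gp0) auto
    also have "\<dots> \<le> 1 / (1 - z)"
      using z by (intro divide_right_mono) auto
    finally show "0 \<le> (\<Sum>k\<le>m. z ^ k) \<and> (\<Sum>k\<le>m. z ^ k) \<le> 1 / (1 - z)"
      using z by (simp add: sum_nonneg)
  qed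
  finally show ?thesis
    using z by (simp add: field_simps)
qed

text \<open>
  The vector that determines a face is a sum of at most \<open>card E\<close> coefficient vectors \<open>P i - N i\<close>.
  Summing the \<open>P i\<close> and the \<open>N i\<close> separately gives two vectors with entry sums at most
  \<open>p * card E\<close> and \<open>q * card E\<close>, whatever the number of constraints.
\<close>

lemma
  fixes P N :: "'i \<Rightarrow> 'e \<Rightarrow> nat"
  assumes E: "finite E" and I: "finite I"
    and P: "\<And>i. i \<in> I \<Longrightarrow> sum (P i) E \<le> p" and N: "\<And>i. i \<in> I \<Longrightarrow> sum (N i) E \<le> q"
    and C: "C = {x. Poly_Mapping.keys x \<subseteq> E \<and>
      (\<forall>i\<in>I. 0 \<le> (\<Sum>e\<in>E. (real (P i e) - real (N i e)) * Poly_Mapping.lookup x e))}"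
  shows finite_faces_integer_cone: "finite {F. F face_of C \<and> F \<noteq> {}}" (is "finite ?\<F>")
    and card_faces_integer_cone:
      "card {F. F face_of C \<and> F \<noteq> {}} \<le>
         card (bounded_vectors E (p * card E)) * card (bounded_vectors E (q * card E))"
proof -
  define W where "W i = (\<Sum>e\<in>E. Poly_Mapping.single e (real (P i e) - real (N i e)))" for i
  have lookup_W: "Poly_Mapping.lookup (W i) k = (if k \<in> E then real (P i k) - real (N i k) else 0)" for i k
    using E by (simp add: W_def lookup_sum lookup_single when_def)
  then have W_keys: "Poly_Mapping.keys (W i) \<subseteq> E" for i
    by (auto simp: in_keys_iff split: if_splits)
  have C': "C = {x. Poly_Mapping.keys x \<subseteq> E \<and> (\<forall>i\<in>I. 0 \<le> pairing E (W i) x)}"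
    unfolding C pairing_def by (simp add: lookup_W)
  define cut where "cut = (\<lambda>(u :: 'e \<Rightarrow> nat, v :: 'e \<Rightarrow> nat).
    {x \<in> C. (\<Sum>e\<in>E. (real (u e) - real (v e)) * Poly_Mapping.lookup x e) = 0})"
  define X where "X = bounded_vectors E (p * card E) \<times> bounded_vectors E (q * card E)"
  have "?\<F> \<subseteq> cut ` X"
  proof clarify
    fix F assume F: "F face_of C" "F \<noteq> {}"
    obtain B where B: "B \<subseteq> I" "card B \<le> card E" "F = {x \<in> C. pairing E (\<Sum>i\<in>B. W i) x = 0}"
      using face_eq_vanishing_of_short_sum[OF E I W_keys C' F] by blast
    have bounded: "restrict (\<lambda>e. \<Sum>i\<in>B. R i e) E \<in> bounded_vectors E (r * card E)"
      if R: "\<And>i. i \<in> I \<Longrightarrow> sum (R i) E \<le> r" for R r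
    proof -
      have "(\<Sum>e\<in>E. \<Sum>i\<in>B. R i e) = (\<Sum>i\<in>B. sum (R i) E)"
        by (rule sum.swap)
      also have "\<dots> \<le> card B * r"
        using R B by (intro sum_bounded_above[where 'a = nat, simplified]) auto
      also have "\<dots> \<le> r * card E"
        using B by simp
      finally show ?thesis by (simp add: bounded_vectors_def)
    qed
    define u where "u = restrict (\<lambda>e. \<Sum>i\<in>B. P i e) E"
    define v where "v = restrict (\<lambda>e. \<Sum>i\<in>B. N i e) E"
    have "pairing E (\<Sum>i\<in>B. W i) x = (\<Sum>e\<in>E. (real (u e) - real (v e)) * Poly_Mapping.lookup x e)" for x
      unfolding pairing_def by (rule sum.cong) (auto simp: u_def v_def lookup_sum lookup_W sum_subtractf)
    then have "F = cut (u, v)"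
      using B(3) by (simp add: cut_def)
    moreover have "(u, v) \<in> X"
      unfolding X_def u_def v_def using bounded P N by blast
    ultimately show "F \<in> cut ` X" by blast
  qed
  moreover have "finite X"
    unfolding X_def using E by (simp add: finite_bounded_vectors)
  ultimately have "finite ?\<F>" "card ?\<F> \<le> card X"
    by (auto intro: finite_surj surj_card_le)
  then show "finite ?\<F>"
    "card ?\<F> \<le> card (bounded_vectors E (p * card E)) * card (bounded_vectors E (q * card E))"
    by (simp_all add: X_def card_cartesian_product)
qed

section \<open>The metric cone\<close>

lemma
  shows finite_metric_cone_faces: "finite (metric_cone_faces n)"
    and card_metric_cone_faces_le: "real (card (metric_cone_faces n)) \<le> 27 ^ (n choose 2)"
proof -
  define E where "E = nsets {1..n} 2"
  define I where "I = {(a, b, c). a \<in> {1..n} \<and> b \<in> {1..n} \<and> c \<in> {1..n} \<and> a \<noteq> b \<and> b \<noteq> c \<and> a \<noteq> c}"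
  define P where "P = (\<lambda>(a, b, c) (e :: nat set). of_bool (e = {a, b}) + of_bool (e = {b, c}) :: nat)"
  define N where "N = (\<lambda>(a, b :: nat, c) (e :: nat set). of_bool (e = {a, c}) :: nat)"
  have finE: "finite E"
    by (simp add: E_def finite_imp_finite_nsets)
  have cardE: "card E = n choose 2"
    proof -
    have "E = {e. e \<subseteq> {1..n} \<and> card e = 2}"
      by (auto simp: E_def nsets_def intro: finite_subset)
    then show ?thesis
      using n_subsets[of "{1..n}" 2] by simp
  qed
  have "I \<subseteq> {1..n} \<times> {1..n} \<times> {1..n}"
    by (auto simp: I_def)
  then have finI: "finite I"
    by (rule finite_subset) auto
  have sums: "(\<Sum>e\<in>E. of_bool (e = e0) * f e) = f e0" if "e0 \<in> E" for e0 and f :: "nat set \<Rightarrow> real"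
    using that finE by (simp add: of_bool_def if_distrib[of "\<lambda>x. x * _"] cong: if_cong)
  have sums_nat: "(\<Sum>e\<in>E. of_bool (e = e0)) \<le> (1 :: nat)" for e0
    using finE by (simp add: of_bool_def)
  have P: "sum (P i) E \<le> 2" and N: "sum (N i) E \<le> 1" for i
    using sums_nat[of "{fst i, fst (snd i)}"] sums_nat[of "{fst (snd i), snd (snd i)}"]
      sums_nat[of "{fst i, snd (snd i)}"]
    by (auto simp: P_def N_def sum.distrib split: prod.splits)
  have form: "(\<Sum>e\<in>E. (real (P (a, b, c) e) - real (N (a, b, c) e)) * Poly_Mapping.lookup x e) =
      Poly_Mapping.lookup x {a, b} + Poly_Mapping.lookup x {b, c} - Poly_Mapping.lookup x {a, c}"
    if "(a, b, c) \<in> I" for a b c x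
  proof -
    have "{a, b} \<in> E" "{b, c} \<in> E" "{a, c} \<in> E"
      using that by (auto simp: E_def I_def)
    then show ?thesis
      by (simp add: P_def N_def left_diff_distrib distrib_right sum.distrib sum_subtractf sums)
  qed
  have cone: "metric_cone n = {x. Poly_Mapping.keys x \<subseteq> E \<and>
      (\<forall>i\<in>I. 0 \<le> (\<Sum>e\<in>E. (real (P i e) - real (N i e)) * Poly_Mapping.lookup x e))}"
    unfolding metric_cone_def E_def[symmetric] using form by (auto simp: I_def)
  note faces = finE finI P N cone
  show "finite (metric_cone_faces n)"
    unfolding metric_cone_faces_def by (rule finite_faces_integer_cone[OF faces])
  have "card (metric_cone_faces n) \<le>
      card (bounded_vectors E (2 * card E)) * card (bounded_vectors E (1 * card E))"
    unfolding metric_cone_faces_def by (rule card_faces_integer_cone[OF faces])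
  then have "real (card (metric_cone_faces n)) \<le>
      real (card (bounded_vectors E (2 * card E))) * real (card (bounded_vectors E (1 * card E)))"
    by (metis of_nat_le_iff of_nat_mult)
  \<comment> \<open>The weights \<open>p / (p + 1)\<close> for \<open>p = 2\<close> and \<open>p = 1\<close>.\<close>
  also have "\<dots> \<le> ((1 / (2/3)) ^ (2 * card E) * (1 / (1 - 2/3)) ^ card E) *
      ((1 / (1/2)) ^ (1 * card E) * (1 / (1 - 1/2)) ^ card E)"
    by (intro mult_mono card_bounded_vectors_le finE) auto
  also have "\<dots> = ((9/4) * 3 * (2 * 2)) ^ card E"
    by (simp add: power_mult power_mult_distrib[symmetric] power2_eq_square)
  finally show "real (card (metric_cone_faces n)) \<le> 27 ^ (n choose 2)"
    by (simp add: cardE)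
qed

theorem theorem5p5:
  shows "(\<forall>n. finite (metric_cone_faces n)) \<and>
    (\<exists>\<epsilon> :: nat \<Rightarrow> real. \<epsilon> \<in> o(\<lambda>_. 1) \<and>
      (\<forall>\<^sub>F n in sequentially.
        real (card (metric_cone_faces n)) \<le> 2 powr (2.38 * (real n)\<^sup>2 * (1 + \<epsilon> n))))"
proof -
  have bound: "real (card (metric_cone_faces n)) \<le> 2 powr (2.38 * (real n)\<^sup>2)" for n
  proof -
    have "(27::real) = 2 powr (log 2 27)" by simp
    also have "\<dots> \<le> 2 powr 4.76"
    proof -
      \<comment> \<open>\<open>4.76 = 119 / 25\<close>\<close>
      have "(27::real) ^ 25 \<le> 2 ^ 119" by simp
      then have "log 2 (27 ^ 25) \<le> log 2 (2 ^ 119 :: real)"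
        by (subst log_le_cancel_iff) auto
      then have "25 * log 2 27 \<le> (119 :: real)"
        using log_nat_power[of 27 2 25] log_pow_cancel[of 2 119] by linarith
      then show ?thesis by (intro powr_mono) auto
    qed
    finally have base: "(27::real) \<le> 2 powr 4.76" .
    have "real (n choose 2) = real n * (real n - 1) / 2"
      by (induction n) (simp_all add: numeral_2_eq_2 field_simps)
    then have pairs: "real (n choose 2) \<le> (real n)\<^sup>2 / 2"
      by (simp add: power2_eq_square algebra_simps)
    have "real (card (metric_cone_faces n)) \<le> 27 ^ (n choose 2)"
      by (rule card_metric_cone_faces_le)
    also have "\<dots> \<le> (2 powr 4.76) ^ (n choose 2)"
      by (intro power_mono base) auto
    also have "\<dots> = 2 powr (4.76 * real (n choose 2))"
      by (simp add: powr_powr powr_realpow[symmetric])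
    also have "\<dots> \<le> 2 powr (2.38 * (real n)\<^sup>2)"
      using pairs by (intro powr_mono) auto
    finally show ?thesis .
  qed
  have "(\<lambda>_. 0 :: real) \<in> o(\<lambda>_ :: nat. 1)"
    by simp
  moreover have "\<forall>\<^sub>F n in sequentially.
      real (card (metric_cone_faces n)) \<le> 2 powr (2.38 * (real n)\<^sup>2 * (1 + 0))"
    using bound by simp
  ultimately show ?thesis
    using finite_metric_cone_faces by (intro conjI allI exI[of _ "\<lambda>_. 0"]) auto
qed

end
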